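(* Let $n\ge 3$ be an integer. (i) For every $n$-gon center $\mathfrak Z_n:\mathcal F_n\to\mathbb R^2$ and every $P\in\mathcal F_n$, the point $\mathfrak Z_n(P)$ belongs to the set of points fixed by the group of symmetries of $P$. (ii) Conversely, for every $P\in\mathcal P_n$ and every point $X\in\mathbb R^2$ in the set of points fixed by the group of symmetries of $P$, there exists an $n$-gon center $\mathfrak Z_n:\mathcal P_n\to\mathbb R^2$, defined on all of $\mathcal P_n$, such that $\mathfrak Z_n(P)=X$.
   Context: For $n\ge3$, an $n$-gon is a multiset of $n$ points of $\mathbb R^2$ (its vertices; repetitions, collinearities and self-intersections are allowed) endowed with a symmetric irreflexive adjacency relation $\mathcal A$ between its vertices such that each vertex is adjacent to exactly two vertices and, for every pair of vertices $V,V'$, there are exactly two sequences of successively adjacent vertices from $V$ to $V'$ meeting only at their endpoints; i.e. the adjacency relation makes the vertices into a single $n$-cycle. Equivalently, an $n$-gon is given by a labelling $(V_1,\dots,V_n)\in(\mathbb R^2)^n$ of its vertices with $V_i,V_j$ adjacent iff $i,j$ are consecutive modulo $n$, and two labellings define the same $n$-gon iff one is obtained from the other by $(V_1,\dots,V_n)\mapsto(V_{\alpha(1)},\dots,V_{\alpha(n)})$ for some $\alpha$ in the dihedral subgroup $D_n<S_n$ generated by $\rho(i)=i+1 \bmod n$ and $\sigma(i)=n-i+2\bmod n$. $\mathcal P_n$ denotes the set of all $n$-gons. $E(2)$ is the group of rigid motions (isometries, including reflections) of the plane and $S(2)\supset E(2)$ the group of similarities of the plane. A similarity $T\in S(2)$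 acts on $\mathcal P_n$ by applying $T$ to each vertex and transporting the adjacency relation: $T(V)$ and $T(W)$ are adjacent in $T(P)$ iff $V$ and $W$ are adjacent in $P$; in terms of labellings, $(V_1,\dots,V_n)\mapsto(T(V_1),\dots,T(V_n))$. The group of symmetries of $P\in\mathcal P_n$ is the subgroup of all $T\in E(2)$ with $T(P)=P$ (as $n$-gons). A point $X$ is fixed by this group if $T(X)=X$ for every $T$ in it. An $n$-gon center is a function $\mathfrak X_n:\mathcal F_n\to\mathbb R^2$, where $\mathcal F_n$ is a non-empty subset of $\mathcal P_n$ closed under the action of similarities, that commutes with similarities: $\mathfrak X_n(T(P))=T(\mathfrak X_n(P))$ for all $T\in S(2)$ and all $P\in\mathcal F_n$. *)

theory Defs
  imports "HOL-Analysis.Analysis" "HOL-Algebra.Sym_Groups" "HOL-Algebra.Generated_Groups"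
begin

type_synonym plane = "real ^ 2"

text \<open>Residues modulo \<open>n\<close> are represented in \<open>{1..n}\<close>, i.e. by \<open>(k - 1) mod n + 1\<close>: the two
  permutations are \<open>i \<mapsto> i + 1\<close> and \<open>i \<mapsto> n - i + 2\<close>, and the identity outside \<open>{1..n}\<close>.\<close>

definition rho_perm :: "nat \<Rightarrow> nat \<Rightarrow> nat" where
  "rho_perm n i = (if i \<in> {1..n} then i mod n + 1 else i)"

definition sigma_perm :: "nat \<Rightarrow> nat \<Rightarrow> nat" where
  "sigma_perm n i = (if i \<in> {1..n} then (n - i + 1) mod n + 1 else i)"

definition dihedral :: "nat \<Rightarrow> (nat \<Rightarrow> nat) set" where
  "dihedral n = generate (sym_group n) {rho_perm n, sigma_perm n}"

definition labellings :: "nat \<Rightarrow> (nat \<Rightarrow> plane) set" where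
  "labellings n = {1..n} \<rightarrow>\<^sub>E UNIV"

definition same_ngon :: "nat \<Rightarrow> ((nat \<Rightarrow> plane) \<times> (nat \<Rightarrow> plane)) set" where
  "same_ngon n =
     {(v, w). v \<in> labellings n \<and> w \<in> labellings n \<and>
        (\<exists>\<alpha>\<in>dihedral n. w = (\<lambda>i\<in>{1..n}. v (\<alpha> i)))}"

text \<open>An \<open>n\<close>-gon is the set of all its labellings. The vertices with labels \<open>i\<close> and \<open>j\<close> are
  adjacent iff \<open>i\<close> and \<open>j\<close> are consecutive modulo \<open>n\<close>. For \<open>n \<ge> 3\<close>, the permutations of
  the labels that preserve this relation are exactly those in \<open>dihedral n\<close>.\<close>

type_synonym ngon = "(nat \<Rightarrow> plane) set"

definition ngons :: "nat \<Rightarrow> ngon set" where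
  "ngons n = labellings n // same_ngon n"

lemma rho_perm_permutes: "rho_perm n permutes {1..n}"
proof -
  have "inj_on (rho_perm n) {1..n}"
  proof (rule inj_onI)
    fix x y assume a: "x \<in> {1..n}" "y \<in> {1..n}" "rho_perm n x = rho_perm n y"
    then have "x mod n = y mod n" by (auto simp: rho_perm_def)
    then show "x = y" using a by (cases "x = n"; cases "y = n") auto
  qed
  moreover have "rho_perm n ` {1..n} \<subseteq> {1..n}" by (auto simp: rho_perm_def Suc_le_eq)
  ultimately have "bij_betw (rho_perm n) {1..n} {1..n}"
    by (simp add: bij_betw_def endo_inj_surj)
  then show ?thesis by (rule bij_imp_permutes) (auto simp: rho_perm_def)
qed

lemma sigma_perm_permutes: "sigma_perm n permutes {1..n}"
proof -
  have "inj_on (sigma_perm n) {1..n}"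
  proof (rule inj_onI)
    fix x y assume a: "x \<in> {1..n}" "y \<in> {1..n}" "sigma_perm n x = sigma_perm n y"
    then have "(n - x + 1) mod n = (n - y + 1) mod n" by (auto simp: sigma_perm_def)
    then show "x = y" using a by (cases "x = 1"; cases "y = 1") (auto dest!: dvd_imp_le)
  qed
  moreover have "sigma_perm n ` {1..n} \<subseteq> {1..n}" by (auto simp: sigma_perm_def Suc_le_eq)
  ultimately have "bij_betw (sigma_perm n) {1..n} {1..n}"
    by (simp add: bij_betw_def endo_inj_surj)
  then show ?thesis by (rule bij_imp_permutes) (auto simp: sigma_perm_def)
qed

lemma subgroup_dihedral: "subgroup (dihedral n) (sym_group n)"
  unfolding dihedral_def
  by (rule group.generate_is_subgroup[OF sym_group_is_group])
     (simp add: sym_group_carrier rho_perm_permutes[simplified] sigma_perm_permutes[simplified])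

lemma dihedral_permutes: "\<alpha> \<in> dihedral n \<Longrightarrow> \<alpha> permutes {1..n}"
  using subgroup.subset[OF subgroup_dihedral] by (metis subsetD sym_group_carrier)

lemma equiv_same_ngon: "equiv (labellings n) (same_ngon n)"
proof (rule equivI)
  show "same_ngon n \<subseteq> labellings n \<times> labellings n" by (auto simp: same_ngon_def)
  show "refl_on (labellings n) (same_ngon n)"
  proof (rule refl_onI)
    fix v assume v: "v \<in> labellings n"
    have "id \<in> dihedral n"
      using subgroup.one_closed[OF subgroup_dihedral] by (simp add: sym_group_one)
    moreover have "v = (\<lambda>i\<in>{1..n}. v (id i))"
      using v by (auto simp: labellings_def PiE_def extensional_def fun_eq_iff)
    ultimately show "(v, v) \<in> same_ngon n" using v unfolding same_ngon_def by blast
  qed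
  show "sym (same_ngon n)"
  proof (rule symI)
    fix v w assume "(v, w) \<in> same_ngon n"
    then obtain \<alpha> where a: "\<alpha> \<in> dihedral n" "w = (\<lambda>i\<in>{1..n}. v (\<alpha> i))"
      and vw: "v \<in> labellings n" "w \<in> labellings n" unfolding same_ngon_def by blast
    have c: "\<alpha> \<in> carrier (sym_group n)" using a subgroup.subset[OF subgroup_dihedral] by blast
    have p: "\<alpha> permutes {1..n}" by (rule dihedral_permutes[OF a(1)])
    have d: "inv' \<alpha> \<in> dihedral n"
      using subgroup.m_inv_closed[OF subgroup_dihedral a(1)] by (simp add: sym_group_inv_equality[OF c])
    have "v = (\<lambda>i\<in>{1..n}. w (inv' \<alpha> i))"
      using vw a(2) permutes_in_image[OF permutes_inv[OF p]] permutes_inverses[OF p]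
      by (auto simp: labellings_def PiE_def extensional_def fun_eq_iff)
    with d vw show "(w, v) \<in> same_ngon n" unfolding same_ngon_def by blast
  qed
  show "trans (same_ngon n)"
  proof (rule transI)
    fix u v w assume "(u, v) \<in> same_ngon n" "(v, w) \<in> same_ngon n"
    then obtain \<alpha> \<beta> where a: "\<alpha> \<in> dihedral n" "v = (\<lambda>i\<in>{1..n}. u (\<alpha> i))"
      and b: "\<beta> \<in> dihedral n" "w = (\<lambda>i\<in>{1..n}. v (\<beta> i))"
      and uw: "u \<in> labellings n" "w \<in> labellings n" unfolding same_ngon_def by blast
    have "\<alpha> \<circ> \<beta> \<in> dihedral n"
      using subgroup.m_closed[OF subgroup_dihedral a(1) b(1)] by (simp add: sym_group_mult)
    moreover have "w = (\<lambda>i\<in>{1..n}. u ((\<alpha> \<circ> \<beta>) i))"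
      using a(2) b(2) permutes_in_image[OF dihedral_permutes[OF b(1)]] by (auto simp: fun_eq_iff)
    ultimately show "(u, w) \<in> same_ngon n" using uw unfolding same_ngon_def by blast
  qed
qed

text \<open>Reflections are included. Bijectivity is automatic in the plane.\<close>

definition similarities :: "(plane \<Rightarrow> plane) set" where
  "similarities = {T. bij T \<and> (\<exists>c>0. \<forall>x y. dist (T x) (T y) = c * dist x y)}"

definition rigid_motions :: "(plane \<Rightarrow> plane) set" where
  "rigid_motions = {T. bij T \<and> (\<forall>x y. dist (T x) (T y) = dist x y)}"

definition act :: "nat \<Rightarrow> (plane \<Rightarrow> plane) \<Rightarrow> ngon \<Rightarrow> ngon" where
  "act n T P = (\<lambda>v. \<lambda>i\<in>{1..n}. T (v i)) ` P"

lemma act_class: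
  assumes "v \<in> labellings n" "bij T"
  shows "act n T (same_ngon n `` {v}) = same_ngon n `` {\<lambda>i\<in>{1..n}. T (v i)}" (is "?L = ?R")
proof
  show "?L \<subseteq> ?R"
  proof
    fix w assume "w \<in> ?L"
    then obtain \<alpha> where a: "\<alpha> \<in> dihedral n" "w = (\<lambda>i\<in>{1..n}. T ((\<lambda>i\<in>{1..n}. v (\<alpha> i)) i))"
      by (auto simp: act_def same_ngon_def)
    have "w = (\<lambda>i\<in>{1..n}. (\<lambda>i\<in>{1..n}. T (v i)) (\<alpha> i))"
      using a(2) permutes_in_image[OF dihedral_permutes[OF a(1)]] by (auto simp: fun_eq_iff)
    then show "w \<in> ?R" using a(1) unfolding same_ngon_def labellings_def by auto
  qed
  show "?R \<subseteq> ?L"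
  proof
    fix w assume "w \<in> ?R"
    then obtain \<alpha> where a: "\<alpha> \<in> dihedral n" "w = (\<lambda>i\<in>{1..n}. (\<lambda>i\<in>{1..n}. T (v i)) (\<alpha> i))"
      by (auto simp: same_ngon_def)
    let ?u = "\<lambda>i\<in>{1..n}. v (\<alpha> i)"
    have "w = (\<lambda>i\<in>{1..n}. T (?u i))"
      using a(2) permutes_in_image[OF dihedral_permutes[OF a(1)]] by (auto simp: fun_eq_iff)
    moreover have "(v, ?u) \<in> same_ngon n"
      using assms(1) a(1) unfolding same_ngon_def labellings_def by auto
    ultimately show "w \<in> ?L" unfolding act_def by blast
  qed
qed

definition symmetries :: "nat \<Rightarrow> ngon \<Rightarrow> (plane \<Rightarrow> plane) set" where
  "symmetries n P = {T \<in> rigid_motions. act n T P = P}"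

definition fixed_points :: "(plane \<Rightarrow> plane) set \<Rightarrow> plane set" where
  "fixed_points G = {X. \<forall>T\<in>G. T X = X}"

text \<open>The values of \<open>Z\<close> outside its domain \<open>F\<close> are irrelevant.\<close>

definition ngon_center :: "nat \<Rightarrow> ngon set \<Rightarrow> (ngon \<Rightarrow> plane) \<Rightarrow> bool" where
  "ngon_center n F Z \<longleftrightarrow>
     F \<noteq> {} \<and> F \<subseteq> ngons n \<and>
     (\<forall>T\<in>similarities. \<forall>P\<in>F. act n T P \<in> F) \<and>
     (\<forall>T\<in>similarities. \<forall>P\<in>F. Z (act n T P) = T (Z P))"

end

theory Submission imports Defs begin

text \<open>
  A center commutes with every similarity, so if a rigid motion maps \<open>P\<close> to itself it also maps
  the center of \<open>P\<close> to itself; this is the first half.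

  For the converse, the required center must send \<open>T P\<close> to \<open>T X\<close> for every similarity \<open>T\<close>, which
  fixes it on the orbit of \<open>P\<close>. Outside this orbit, which the similarities also preserve, the
  centroid of the vertices can be used, since similarities are affine.

  The only point at issue is that \<open>T X\<close> depends on the polygon \<open>T P\<close> alone, that is, that \<open>X\<close> is
  fixed by every similarity that maps \<open>P\<close> to itself, whereas by hypothesis it is fixed
  only by the rigid motions that do so. This is \<open>fixed_point_of_stabilizer\<close>. A similarity of ratio
  \<open>c\<close> that permutes the vertices of \<open>P\<close> preserves the sum of all distances between vertices and
  also multiplies it by \<open>c\<close>. Hence either \<open>c = 1\<close> and the similarity is a rigid motion, or all
  vertices coincide in one point \<open>A\<close>. In the latter case the half-turn about \<open>A\<close> is a symmetry of
  \<open>P\<close> with no fixed point other than \<open>A\<close>, so \<open>X = A\<close>, and every similarity preserving \<open>P\<close> fixes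
  \<open>A\<close>.
\<close>

section \<open>The similarity group and its action on polygons\<close>

lemma rigid_motions_subset_similarities: "rigid_motions \<subseteq> similarities"
  unfolding rigid_motions_def similarities_def by (auto intro!: exI[of _ 1])

lemma id_in_similarities: "id \<in> similarities"
  unfolding similarities_def by (auto intro!: exI[of _ 1])

lemma comp_in_similarities:
  assumes "S \<in> similarities" "T \<in> similarities"
  shows "S \<circ> T \<in> similarities"
proof -
  from assms obtain c d where "c > 0" "\<forall>x y. dist (S x) (S y) = c * dist x y"
    and "d > 0" "\<forall>x y. dist (T x) (T y) = d * dist x y"
    unfolding similarities_def by blast
  then have "c * d > 0" "\<forall>x y. dist ((S \<circ> T) x) ((S \<circ> T) y) = (c * d) * dist x y"
    by (auto simp: mult.assoc)
  moreover have "bij (S \<circ> T)"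
    using assms by (auto simp: similarities_def intro: bij_comp)
  ultimately show ?thesis unfolding similarities_def by blast
qed

lemma inv_in_similarities:
  assumes "T \<in> similarities"
  shows "inv' T \<in> similarities"
proof -
  from assms obtain c where c: "c > 0" "\<And>x y. dist (T x) (T y) = c * dist x y" and b: "bij T"
    unfolding similarities_def by blast
  have "dist (inv' T x) (inv' T y) = (1 / c) * dist x y" for x y
    using c(1) c(2)[of "inv' T x" "inv' T y"] b by (simp add: bij_is_surj surj_f_inv_f field_simps)
  then show ?thesis
    using c(1) b by (auto simp: similarities_def bij_imp_bij_inv intro!: exI[of _ "1 / c"])
qed

text \<open>Subtracting \<open>T 0\<close> and dividing by the ratio turns \<open>T\<close> into an isometry that fixes the
  origin, which is linear. Affinity is what makes \<open>T\<close> commute with taking centroids.\<close>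

lemma similarity_affine:
  assumes "T \<in> similarities"
  shows "\<exists>L. linear L \<and> (\<forall>x. T x = L x + T 0)"
proof -
  from assms obtain c where c: "c > 0" "\<And>x y. dist (T x) (T y) = c * dist x y"
    unfolding similarities_def by blast
  define f where "f x = (1 / c) *\<^sub>R (T x - T 0)" for x
  have "dist (f x) (f y) = dist x y" for x y
  proof -
    have "f x - f y = (1 / c) *\<^sub>R (T x - T y)"
      unfolding f_def by (simp add: algebra_simps)
    then show ?thesis using c by (simp add: dist_norm)
  qed
  then have "linear f"
    using orthogonal_transformation_isometry[of f] orthogonal_transformation_linear
    by (force simp: f_def)
  then have "linear (\<lambda>x. c *\<^sub>R f x)" by (rule linear_compose_scale_right)
  moreover have "T x = c *\<^sub>R f x + T 0" for x using c(1) by (simp add: f_def)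
  ultimately show ?thesis by blast
qed

lemma ngon_cases:
  assumes "P \<in> ngons n"
  obtains v where "v \<in> labellings n" "P = same_ngon n `` {v}"
  using assms unfolding ngons_def by (rule quotientE)

lemma ngon_subset_labellings: "P \<in> ngons n \<Longrightarrow> P \<subseteq> labellings n"
  by (auto elim!: ngon_cases simp: same_ngon_def)

lemma act_in_ngons:
  assumes "P \<in> ngons n" "bij T"
  shows "act n T P \<in> ngons n"
proof -
  obtain v where v: "v \<in> labellings n" "P = same_ngon n `` {v}"
    using assms(1) by (rule ngon_cases)
  have "(\<lambda>i\<in>{1..n}. T (v i)) \<in> labellings n" by (simp add: labellings_def)
  then show ?thesis using v assms(2) by (simp add: act_class ngons_def quotientI)
qed

lemma act_id:
  assumes "P \<in> ngons n"
  shows "act n id P = P"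
proof -
  have "(\<lambda>i\<in>{1..n}. id (v i)) = v" if "v \<in> P" for v
    using that ngon_subset_labellings[OF assms]
    by (auto simp: labellings_def PiE_def extensional_def fun_eq_iff)
  then show ?thesis by (simp add: act_def)
qed

lemma act_comp: "act n (S \<circ> T) P = act n S (act n T P)"
  unfolding act_def image_image by (intro image_cong refl) auto

lemma act_inv:
  assumes "P \<in> ngons n" "bij T"
  shows "act n (inv' T) (act n T P) = P"
  using assms by (simp add: act_comp[symmetric] act_id inv_o_cancel bij_is_inj)

section \<open>The centroid\<close>

text \<open>The value is read off from an arbitrary labelling of the polygon; by
  \<open>centroid_same_ngon\<close> the choice is immaterial.\<close>

definition centroid :: "nat \<Rightarrow> ngon \<Rightarrow> plane" where
  "centroid n P = (1 / real n) *\<^sub>R (\<Sum>i\<in>{1..n}. (SOME v. v \<in> P) i)"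

lemma centroid_same_ngon:
  assumes v: "v \<in> labellings n"
  shows "centroid n (same_ngon n `` {v}) = (1 / real n) *\<^sub>R (\<Sum>i\<in>{1..n}. v i)"
proof -
  have "v \<in> same_ngon n `` {v}"
    using equiv_class_self[OF equiv_same_ngon v] .
  then have "(SOME w. w \<in> same_ngon n `` {v}) \<in> same_ngon n `` {v}" by (rule someI[where P = "\<lambda>w. w \<in> same_ngon n `` {v}"])
  then obtain \<alpha> where \<alpha>: "\<alpha> \<in> dihedral n"
    "(SOME w. w \<in> same_ngon n `` {v}) = (\<lambda>i\<in>{1..n}. v (\<alpha> i))"
    unfolding same_ngon_def by blast
  have "(\<Sum>i\<in>{1..n}. (SOME w. w \<in> same_ngon n `` {v}) i) = (\<Sum>i\<in>{1..n}. v (\<alpha> i))"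
    unfolding \<alpha>(2) by (intro sum.cong) auto
  also have "\<dots> = (\<Sum>i\<in>{1..n}. v i)"
    using sum.permute[OF dihedral_permutes[OF \<alpha>(1)], of v] by (simp add: o_def)
  finally show ?thesis by (simp add: centroid_def)
qed

lemma centroid_act:
  assumes "n \<ge> 1" "T \<in> similarities" "P \<in> ngons n"
  shows "centroid n (act n T P) = T (centroid n P)"
proof -
  obtain v where v: "v \<in> labellings n" "P = same_ngon n `` {v}"
    using assms(3) by (rule ngon_cases)
  obtain L where L: "linear L" "\<And>x. T x = L x + T 0"
    using similarity_affine[OF assms(2)] by blast
  have Tv: "(\<lambda>i\<in>{1..n}. T (v i)) \<in> labellings n" by (simp add: labellings_def)
  have "bij T" using assms(2) by (simp add: similarities_def)
  then have "centroid n (act n T P) = (1 / real n) *\<^sub>R (\<Sum>i\<in>{1..n}. T (v i))"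
    using v Tv by (simp add: act_class centroid_same_ngon)
  also have "\<dots> = (1 / real n) *\<^sub>R (\<Sum>i\<in>{1..n}. L (v i) + T 0)"
    by (simp flip: L(2))
  also have "\<dots> = (1 / real n) *\<^sub>R L (\<Sum>i\<in>{1..n}. v i) + T 0"
    using assms(1)
    by (simp add: sum.distrib linear_sum[OF L(1)] scaleR_right_distrib sum_constant_scaleR
        del: sum_constant)
  also have "\<dots> = T (centroid n P)"
    using L(2)[of "centroid n P"] linear_scale[OF L(1)] centroid_same_ngon[OF v(1)] v(2)
    by simp
  finally show ?thesis .
qed

section \<open>Points fixed by all similarities preserving a polygon\<close>

lemma act_eq_imp_permutes_vertices:
  assumes v: "v \<in> labellings n" and T: "bij T"
    and eq: "act n T (same_ngon n `` {v}) = same_ngon n `` {v}"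
  obtains \<alpha> where "\<alpha> permutes {1..n}" "\<And>i. i \<in> {1..n} \<Longrightarrow> T (v i) = v (\<alpha> i)"
proof -
  let ?w = "\<lambda>i\<in>{1..n}. T (v i)"
  have "?w \<in> labellings n" by (simp add: labellings_def)
  then have "?w \<in> same_ngon n `` {?w}"
    by (rule equiv_class_self[OF equiv_same_ngon])
  then have "(v, ?w) \<in> same_ngon n"
    using eq unfolding act_class[OF v T] by (simp only: Image_singleton_iff)
  then obtain \<alpha> where a: "\<alpha> \<in> dihedral n" "?w = (\<lambda>i\<in>{1..n}. v (\<alpha> i))"
    unfolding same_ngon_def by blast
  have "T (v i) = v (\<alpha> i)" if "i \<in> {1..n}" for i
    using fun_cong[OF a(2), of i] that by simp
  then show ?thesis using that dihedral_permutes[OF a(1)] by blast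
qed

text \<open>Permuting the vertices does not change the sum of all distances between vertices, but a
  similarity multiplies it by its ratio.\<close>

lemma ratio_one_or_single_point:
  fixes v :: "'i \<Rightarrow> 'a::metric_space"
  assumes fin: "finite I" and perm: "\<alpha> permutes I"
    and Tv: "\<And>i. i \<in> I \<Longrightarrow> T (v i) = v (\<alpha> i)"
    and c: "\<And>x y. dist (T x) (T y) = c * dist x y"
  shows "c = 1 \<or> (\<forall>i\<in>I. \<forall>j\<in>I. v i = v j)"
proof -
  define D where "D = (\<Sum>i\<in>I. \<Sum>j\<in>I. dist (v i) (v j))"
  have inner: "(\<Sum>j\<in>I. dist x (v (\<alpha> j))) = (\<Sum>j\<in>I. dist x (v j))" for x
    using sum.permute[OF perm, of "\<lambda>j. dist x (v j)"] by (simp add: o_def)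
  have "c * D = (\<Sum>i\<in>I. \<Sum>j\<in>I. dist (T (v i)) (T (v j)))"
    by (simp add: D_def c sum_distrib_left)
  also have "\<dots> = (\<Sum>i\<in>I. \<Sum>j\<in>I. dist (v (\<alpha> i)) (v (\<alpha> j)))"
    by (simp add: Tv)
  also have "\<dots> = (\<Sum>i\<in>I. \<Sum>j\<in>I. dist (v (\<alpha> i)) (v j))"
    by (simp only: inner)
  also have "\<dots> = D"
    using sum.permute[OF perm, of "\<lambda>i. \<Sum>j\<in>I. dist (v i) (v j)"] by (simp add: o_def D_def)
  finally have "c = 1 \<or> D = 0" by auto
  moreover have "\<forall>i\<in>I. \<forall>j\<in>I. v i = v j" if "D = 0"
  proof (intro ballI)
    fix i j assume ij: "i \<in> I" "j \<in> I"
    have "(\<Sum>j\<in>I. dist (v i) (v j)) = 0"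
      using that ij(1) fin unfolding D_def
      by (subst (asm) sum_nonneg_eq_0_iff) (auto intro: sum_nonneg)
    then have "dist (v i) (v j) = 0"
      using ij(2) fin by (subst (asm) sum_nonneg_eq_0_iff) auto
    then show "v i = v j" by simp
  qed
  ultimately show ?thesis by blast
qed

lemma half_turn_rigid: "(\<lambda>x. 2 *\<^sub>R A - x) \<in> rigid_motions"
proof -
  have "bij (\<lambda>x. 2 *\<^sub>R A - x)"
    by (rule o_bij[of "\<lambda>x. 2 *\<^sub>R A - x"]) (simp_all add: fun_eq_iff)
  then show ?thesis by (simp add: rigid_motions_def dist_norm norm_minus_commute)
qed

text \<open>If the ratio is not \<open>1\<close>, all vertices coincide in a point \<open>A\<close>, and the half-turn about \<open>A\<close>
  forces \<open>X = A\<close>.\<close>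

lemma fixed_point_of_stabilizer:
  assumes n: "n \<ge> 1" and P: "P \<in> ngons n" and X: "X \<in> fixed_points (symmetries n P)"
    and T: "T \<in> similarities" and TP: "act n T P = P"
  shows "T X = X"
proof -
  obtain v where v: "v \<in> labellings n" "P = same_ngon n `` {v}"
    using P by (rule ngon_cases)
  from T obtain c where c: "\<And>x y. dist (T x) (T y) = c * dist x y" and b: "bij T"
    unfolding similarities_def by blast
  obtain \<alpha> where \<alpha>: "\<alpha> permutes {1..n}" "\<And>i. i \<in> {1..n} \<Longrightarrow> T (v i) = v (\<alpha> i)"
    using act_eq_imp_permutes_vertices[OF v(1) b] TP v(2) by metis
  have "c = 1 \<or> (\<forall>i\<in>{1..n}. \<forall>j\<in>{1..n}. v i = v j)"
    by (rule ratio_one_or_single_point[of _ \<alpha> T]) (use \<alpha> c in auto)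
  then consider "c = 1" | "\<forall>i\<in>{1..n}. \<forall>j\<in>{1..n}. v i = v j"
    by blast
  then show ?thesis
  proof cases
    case 1
    then have "T \<in> symmetries n P"
      using b c TP by (simp add: symmetries_def rigid_motions_def)
    then show ?thesis using X by (simp add: fixed_points_def)
  next
    case 2
    define A where "A = v 1"
    have vA: "v i = A" if "i \<in> {1..n}" for i
      unfolding A_def by (rule 2[rule_format]) (use n that in auto)
    let ?H = "\<lambda>x. 2 *\<^sub>R A - x"
    have "(\<lambda>i\<in>{1..n}. ?H (v i)) = v"
    proof (rule ext)
      fix i
      show "(\<lambda>i\<in>{1..n}. ?H (v i)) i = v i"
        using vA[of i] PiE_arb[OF v(1)[unfolded labellings_def], of i]
        by (cases "i \<in> {1..n}") (simp_all add: scaleR_2)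
    qed
    moreover have "bij ?H" using half_turn_rigid by (simp add: rigid_motions_def)
    ultimately have "act n ?H P = P" using act_class[OF v(1), of ?H] v(2) by simp
    then have "?H \<in> symmetries n P"
      using half_turn_rigid by (simp add: symmetries_def)
    then have "?H X = X" using X unfolding fixed_points_def by blast
    then have "2 *\<^sub>R X = 2 *\<^sub>R A" by (simp add: scaleR_2 algebra_simps)
    then have "X = A" by simp
    moreover have "T A = A"
      using \<alpha>(2)[of 1] vA permutes_in_image[OF \<alpha>(1), of 1] n by simp
    ultimately show ?thesis by simp
  qed
qed

section \<open>Centers and fixed points\<close>

lemma center_in_fixed_points:
  assumes "ngon_center n F Z" "P \<in> F"
  shows "Z P \<in> fixed_points (symmetries n P)"
  unfolding fixed_points_def
proof (intro CollectI ballI)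
  fix T assume "T \<in> symmetries n P"
  then have "T \<in> similarities" "act n T P = P"
    using rigid_motions_subset_similarities by (auto simp: symmetries_def)
  then show "T (Z P) = Z P" using assms unfolding ngon_center_def by metis
qed

lemma center_through_fixed_point:
  assumes n: "n \<ge> 1" and P: "P \<in> ngons n" and X: "X \<in> fixed_points (symmetries n P)"
  shows "\<exists>Z. ngon_center n (ngons n) Z \<and> Z P = X"
proof -
  have bij: "bij T" if "T \<in> similarities" for T
    using that by (simp add: similarities_def)
  \<comment> \<open>The value \<open>T X\<close> is the same for all similarities with the same image of \<open>P\<close>.\<close>
  have well_defined: "S X = T X"
    if S: "S \<in> similarities" and T: "T \<in> similarities" and eq: "act n S P = act n T P" for S T
  proof -
    have "act n (inv' T \<circ> S) P = P"
      using eq act_inv[OF P bij[OF T]] by (simp add: act_comp)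
    then have "(inv' T \<circ> S) X = X"
      using fixed_point_of_stabilizer[OF n P X] comp_in_similarities inv_in_similarities S T
      by blast
    then have "T (inv' T (S X)) = T X" by simp
    then show ?thesis using bij[OF T] by (simp add: bij_is_surj surj_f_inv_f)
  qed
  define orbit where "orbit = {act n T P | T. T \<in> similarities}"
  define Z where "Z Q = (if Q \<in> orbit
      then (SOME T. T \<in> similarities \<and> act n T P = Q) X else centroid n Q)" for Q
  have Z_orbit: "Z (act n T P) = T X" if T: "T \<in> similarities" for T
  proof -
    let ?S = "SOME S. S \<in> similarities \<and> act n S P = act n T P"
    have "?S \<in> similarities \<and> act n ?S P = act n T P"
      by (rule someI[of _ T]) (use T in simp)
    then have "?S X = T X" using well_defined T by blast
    moreover have "act n T P \<in> orbit" using T by (auto simp: orbit_def)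
    ultimately show ?thesis by (simp add: Z_def)
  qed
  have "Z (act n T Q) = T (Z Q)" if T: "T \<in> similarities" and Q: "Q \<in> ngons n" for T Q
  proof (cases "Q \<in> orbit")
    case True
    then obtain S where S: "S \<in> similarities" "Q = act n S P" by (auto simp: orbit_def)
    then show ?thesis
      using Z_orbit[OF comp_in_similarities[OF T S(1)]] Z_orbit[OF S(1)] by (simp add: act_comp)
  next
    case False
    have "act n T Q \<notin> orbit"
    proof
      assume "act n T Q \<in> orbit"
      then obtain S where S: "S \<in> similarities" "act n T Q = act n S P" by (auto simp: orbit_def)
      then have "Q = act n (inv' T \<circ> S) P"
        using act_inv[OF Q bij[OF T]] by (simp add: act_comp)
      with False show False
        using comp_in_similarities[OF inv_in_similarities[OF T] S(1)] by (auto simp: orbit_def)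
    qed
    with False show ?thesis using centroid_act[OF n T Q] by (simp add: Z_def)
  qed
  then have "ngon_center n (ngons n) Z"
    using P act_in_ngons bij by (auto simp: ngon_center_def)
  moreover have "Z P = X"
    using Z_orbit[OF id_in_similarities] by (simp add: act_id[OF P])
  ultimately show ?thesis by blast
qed

theorem theorem9:
  fixes n :: nat
  assumes "n \<ge> 3"
  shows "(\<forall>F Z. ngon_center n F Z \<longrightarrow>
            (\<forall>P\<in>F. Z P \<in> fixed_points (symmetries n P))) \<and>
         (\<forall>P\<in>ngons n. \<forall>X\<in>fixed_points (symmetries n P).
            \<exists>Z. ngon_center n (ngons n) Z \<and> Z P = X)"
proof -
  have "n \<ge> 1" using assms by simp
  then show ?thesis using center_in_fixed_points center_through_fixed_point by blast
qed

end
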